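(* Let $k\ge 3$, let $\mathcal P_k$ be the path with vertices $1,\dots,k$, and let $l\ge 3$ be an integer. There exists a Braess edge $\{i,j\}$ of $\mathcal P_k$ with $j-i+1=l$ (i.e. whose addition creates a cycle of length $l$) if and only if $k>l^2-\frac34 l+\frac{7}{16}$.
   Context: For a connected graph $G$, $\kappa(G)$ denotes Kemeny's constant of the simple random walk on $G$: $\kappa(G)=\sum_{j\neq i} m_{ij}\pi_j$, where $m_{ij}$ is the mean first passage time from $i$ to $j$ and $\pi$ is the stationary distribution; this is independent of $i$. A pair $\{u,v\}$ of nonadjacent vertices of $G$ is a Braess edge of $G$ if adding the edge $\{u,v\}$ to $G$ strictly increases $\kappa$. *)

theory Defs
  imports "HOL-Probability.Probability" "Graph_Theory.Graph_Theory"
begin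

text \<open>
  A finite simple undirected graph is a \<open>pair_graph\<close>: its symmetric, irreflexive arc relation
  contains both orientations of every edge.
\<close>

definition srw_step :: "'a pair_pre_digraph \<Rightarrow> 'a \<Rightarrow> 'a pmf" where
  "srw_step G u = pmf_of_set {v. (u, v) \<in> parcs G}"

text \<open>The trajectory \<open>[X\<^sub>0, \<dots>, X\<^sub>n]\<close> of the walk started at \<open>u\<close>.\<close>

primrec srw :: "'a pair_pre_digraph \<Rightarrow> nat \<Rightarrow> 'a \<Rightarrow> 'a list pmf" where
  "srw G 0 u = return_pmf [u]"
| "srw G (Suc n) u = bind_pmf (srw_step G u) (\<lambda>v. map_pmf (\<lambda>w. u # w) (srw G n v))"

text \<open>The probability that \<open>min {m \<ge> 1. X\<^sub>m = j}\<close> equals \<open>n\<close>, for \<open>n \<ge> 1\<close> and \<open>X\<^sub>0 = i\<close>.\<close>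

definition first_passage_prob :: "'a pair_pre_digraph \<Rightarrow> 'a \<Rightarrow> 'a \<Rightarrow> nat \<Rightarrow> real" where
  "first_passage_prob G i j n =
     measure_pmf.prob (srw G n i) {w. w ! n = j \<and> (\<forall>m\<in>{1..<n}. w ! m \<noteq> j)}"

text \<open>
  On a finite connected graph with at least two vertices the first passage time is almost surely
  finite and the series converges. The summand for \<open>n = 0\<close> vanishes.
\<close>

definition mean_first_passage :: "'a pair_pre_digraph \<Rightarrow> 'a \<Rightarrow> 'a \<Rightarrow> real" where
  "mean_first_passage G i j = (\<Sum>n. real n * first_passage_prob G i j n)"

definition stationary :: "'a pair_pre_digraph \<Rightarrow> 'a pmf \<Rightarrow> bool" where
  "stationary G p \<longleftrightarrow> set_pmf p \<subseteq> pverts G \<and> bind_pmf p (srw_step G) = p"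

definition stationary_dist :: "'a pair_pre_digraph \<Rightarrow> 'a pmf" where
  "stationary_dist G = (THE p. stationary G p)"

text \<open>
  For connected \<open>G\<close> the sum does not depend on the initial vertex \<open>i\<close>, and \<open>kemeny G\<close> is the
  common value.
\<close>

definition kemeny :: "'a pair_pre_digraph \<Rightarrow> real" where
  "kemeny G = (THE c. \<forall>i\<in>pverts G.
     c = (\<Sum>j\<in>pverts G - {i}. mean_first_passage G i j * pmf (stationary_dist G) j))"

definition add_edge :: "'a pair_pre_digraph \<Rightarrow> 'a \<Rightarrow> 'a \<Rightarrow> 'a pair_pre_digraph" where
  "add_edge G u v = G\<lparr>parcs := parcs G \<union> {(u, v), (v, u)}\<rparr>"

definition braess_edge :: "'a pair_pre_digraph \<Rightarrow> 'a \<Rightarrow> 'a \<Rightarrow> bool" where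
  "braess_edge G u v \<longleftrightarrow>
     u \<in> pverts G \<and> v \<in> pverts G \<and> u \<noteq> v \<and> (u, v) \<notin> parcs G \<and>
     kemeny (add_edge G u v) > kemeny G"

definition path_graph :: "nat \<Rightarrow> nat pair_pre_digraph" where
  "path_graph k =
     \<lparr>pverts = {1..k},
      parcs = {(i, j). i \<in> {1..k} \<and> j \<in> {1..k} \<and> (j = i + 1 \<or> i = j + 1)}\<rparr>"

lemma pair_graph_path_graph: "pair_graph (path_graph k)"
proof -
  have "finite (parcs (path_graph k))"
    by (rule finite_subset[of _ "{1..k} \<times> {1..k}"]) (auto simp: path_graph_def)
  then show ?thesis
    by unfold_locales (auto simp: path_graph_def symmetric_def sym_def)
qed

lemma pair_graph_add_edge:
  assumes "pair_graph G" "u \<in> pverts G" "v \<in> pverts G" "u \<noteq> v"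
  shows "pair_graph (add_edge G u v)"
proof -
  interpret pair_graph G by fact
  have "sym (parcs G)"
    using pair_sym_arcs by (simp add: symmetric_def)
  then show ?thesis
    using assms pair_finite_verts pair_finite_arcs
    by unfold_locales
      (auto simp: add_edge_def symmetric_def sym_def
        dest: in_arcsD1 in_arcsD2 pair_no_loops)
qed

lemma strongly_connected_path_graph:
  assumes "k \<ge> 1"
  shows "strongly_connected (path_graph k)"
proof -
  interpret pair_graph "path_graph k" by (rule pair_graph_path_graph)
  have up: "1 \<rightarrow>\<^sup>*\<^bsub>path_graph k\<^esub> Suc n" if "Suc n \<le> k" for n
    using that
  proof (induction n)
    case 0
    then have "1 \<in> pverts (path_graph k)" by (simp add: path_graph_def)
    then show ?case by simp
  next
    case (Suc n)
    have "(Suc n, Suc (Suc n)) \<in> parcs (path_graph k)"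
      using Suc.prems by (auto simp: path_graph_def)
    with Suc show ?case using reachable_adj_trans[of 1 "Suc n"] by simp
  qed
  have "1 \<rightarrow>\<^sup>*\<^bsub>path_graph k\<^esub> v" if "v \<in> pverts (path_graph k)" for v
    using up[of "v - 1"] that by (auto simp: path_graph_def)
  moreover have "v \<rightarrow>\<^sup>*\<^bsub>path_graph k\<^esub> 1" if "v \<in> pverts (path_graph k)" for v
    by (rule symmetric_reachable[OF pair_sym_arcs calculation[OF that]])
  moreover have "pverts (path_graph k) \<noteq> {}"
    using assms by (simp add: path_graph_def)
  ultimately show ?thesis
    unfolding strongly_connected_def with_proj_simps by (blast intro: reachable_trans)
qed

end

theory Submission
  imports Defs
begin

text \<open>
  If \<open>r\<close> is the effective resistance, the mean first passage times are
  \<open>m\<^sub>i\<^sub>j = \<Sum>\<^sub>z d\<^sub>z (r\<^sub>i\<^sub>j + r\<^sub>j\<^sub>z - r\<^sub>i\<^sub>z) / 2\<close>: this function solves the first-step equations, and any solution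
  of them on a finite graph is the mean first passage time. Consequently
  \<open>\<kappa> = \<Sum>\<^sub>i\<^sub>j d\<^sub>i d\<^sub>j r\<^sub>i\<^sub>j / (4 m)\<close> for a graph with \<open>m\<close> edges. The stationary distribution is unique
  by the same equations, since \<open>\<pi>\<^sub>j m\<^sub>j\<^sub>j = 1\<close>.

  For the path with a chord closing a cycle of length \<open>l = L + 1\<close> and leaving tails of \<open>p\<close> and \<open>q\<close>
  vertices, the resistances are explicit, and \<open>\<kappa>\<close> increases by \<open>1 / (6 k)\<close> times
  \<open>4 N\<^sup>2 - 4 L\<^sup>2 N - (L - 1)\<^sup>2 (L + 1) - 12 p q (1 + L\<^sup>2 / (L + 1))\<close>, where \<open>N = p + q = k - l\<close>. This is largest
  when one tail is empty, which leaves a quadratic inequality in the integer \<open>N\<close>.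
\<close>

section \<open>First passage times via the killed walk\<close>

lemma prob_bind_pmf_finite:
  assumes "finite A" "set_pmf p \<subseteq> A"
  shows "measure_pmf.prob (bind_pmf p f) X = (\<Sum>x\<in>A. pmf p x * measure_pmf.prob (f x) X)"
proof -
  \<comment> \<open>Turns the probability of an event into a point mass on \<open>bool\<close>, so
    that \<open>pmf_bind\<close> applies.\<close>
  have *: "measure_pmf.prob q X = pmf (map_pmf (\<lambda>w. w \<in> X) q) True" for q
    by (simp add: pmf_map vimage_def)
  have "measure_pmf.prob (bind_pmf p f) X =
      measure_pmf.expectation p (\<lambda>x. measure_pmf.prob (f x) X)"
    by (simp add: * map_bind_pmf pmf_bind)
  also have "\<dots> = (\<Sum>x\<in>A. pmf p x * measure_pmf.prob (f x) X)"
    using assms by (subst integral_measure_pmf[of A]) auto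
  finally show ?thesis .
qed

section \<open>First-step analysis of the walk on a finite symmetric graph\<close>

definition neighbors :: "'a pair_pre_digraph \<Rightarrow> 'a \<Rightarrow> 'a set" where
  "neighbors G u = {v. (u, v) \<in> parcs G}"

definition deg :: "'a pair_pre_digraph \<Rightarrow> 'a \<Rightarrow> real" where
  "deg G u = real (card (neighbors G u))"

text \<open>Transition operator of the walk killed on entering \<open>j\<close>. The start
  \<open>i\<close> may equal \<open>j\<close>, so return times are covered too.\<close>

definition killed_op :: "'a pair_pre_digraph \<Rightarrow> 'a \<Rightarrow> ('a \<Rightarrow> real) \<Rightarrow> 'a \<Rightarrow> real" where
  "killed_op G j g i = (\<Sum>v\<in>pverts G - {j}. pmf (srw_step G i) v * g v)"

locale walk_graph = pair_graph G for G :: "'a pair_pre_digraph" +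
  assumes verts_nonempty: "pverts G \<noteq> {}"
    and neighbors_nonempty: "u \<in> pverts G \<Longrightarrow> neighbors G u \<noteq> {}"
begin

lemma neighbors_subset: "neighbors G u \<subseteq> pverts G"
  by (auto simp: neighbors_def dest: in_arcsD2)

lemma finite_neighbors: "finite (neighbors G u)"
  using finite_subset[OF neighbors_subset] pair_finite_verts by blast

lemma deg_pos: "u \<in> pverts G \<Longrightarrow> deg G u > 0"
  using neighbors_nonempty finite_neighbors by (simp add: deg_def card_gt_0_iff)

lemma neighbors_sym: "v \<in> neighbors G u \<longleftrightarrow> u \<in> neighbors G v"
  using pair_sym_arcs by (auto simp: neighbors_def symmetric_def sym_def)

lemma pmf_srw_step:
  "u \<in> pverts G \<Longrightarrow> pmf (srw_step G u) v = (if v \<in> neighbors G u then 1 / deg G u else 0)"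
  using neighbors_nonempty finite_neighbors
  by (auto simp: srw_step_def neighbors_def deg_def indicator_def)

lemma set_srw_step: "u \<in> pverts G \<Longrightarrow> set_pmf (srw_step G u) = neighbors G u"
  using neighbors_nonempty finite_neighbors by (simp add: srw_step_def neighbors_def)

lemma sum_pmf_srw_step:
  assumes "u \<in> pverts G"
  shows "(\<Sum>v\<in>pverts G. pmf (srw_step G u) v * g v) = (\<Sum>v\<in>neighbors G u. g v) / deg G u"
proof -
  have "(\<Sum>v\<in>pverts G. pmf (srw_step G u) v * g v) = (\<Sum>v\<in>neighbors G u. g v / deg G u)"
    using assms neighbors_subset
    by (intro sum.mono_neutral_cong_right pair_finite_verts) (auto simp: pmf_srw_step)
  then show ?thesis by (simp add: sum_divide_distrib)
qed

lemma first_passage_prob_Suc: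
  assumes "i \<in> pverts G"
  shows "first_passage_prob G i j (Suc n) = (\<Sum>v\<in>pverts G. pmf (srw_step G i) v *
     measure_pmf.prob (srw G n v) {w. w ! n = j \<and> (\<forall>m<n. w ! m \<noteq> j)})"
proof -
  \<comment> \<open>Dropping the start shifts time by one, so the avoidance condition now includes
    time 0 of the remaining walk.\<close>
  have "(#) i -` {w. w ! Suc n = j \<and> (\<forall>m\<in>{1..<Suc n}. w ! m \<noteq> j)} =
      {w. w ! n = j \<and> (\<forall>m<n. w ! m \<noteq> j)}"
    by (auto simp: nth_Cons split: nat.splits)
  then show ?thesis
    unfolding first_passage_prob_def srw.simps using assms neighbors_subset pair_finite_verts
    by (subst prob_bind_pmf_finite[of "pverts G"]) (auto simp: set_srw_step)
qed

lemma first_passage_prob_1: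
  assumes "i \<in> pverts G" "j \<in> pverts G"
  shows "first_passage_prob G i j (Suc 0) = pmf (srw_step G i) j"
proof -
  have "first_passage_prob G i j (Suc 0) =
      (\<Sum>v\<in>pverts G. if v = j then pmf (srw_step G i) v else 0)"
    unfolding first_passage_prob_Suc[OF assms(1)] by (intro sum.cong) auto
  then show ?thesis using assms pair_finite_verts by simp
qed

lemma srw_nth_0: "w \<in> set_pmf (srw G n v) \<Longrightarrow> w ! 0 = v"
  by (cases n) auto

text \<open>A passage at time 2 or later cannot begin with a step to \<open>j\<close>. From any
  other vertex, avoiding \<open>j\<close> at time 0 is automatic, so the shifted event is again a
  first passage up to a null set.\<close>

lemma first_passage_prob_Suc_Suc:
  assumes "i \<in> pverts G" "j \<in> pverts G"
  shows "first_passage_prob G i j (Suc (Suc n)) =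
     killed_op G j (\<lambda>v. first_passage_prob G v j (Suc n)) i"
proof -
  let ?A = "{w. w ! Suc n = j \<and> (\<forall>m<Suc n. w ! m \<noteq> j)}"
  have j: "measure_pmf.prob (srw G (Suc n) j) ?A = 0"
    by (subst measure_pmf_zero_iff) (use srw_nth_0[of _ "Suc n" j] in blast)
  have v: "measure_pmf.prob (srw G (Suc n) v) ?A = first_passage_prob G v j (Suc n)"
    if "v \<noteq> j" for v
    unfolding first_passage_prob_def
  proof (intro measure_prob_cong_0)
    fix w assume w: "w \<in> ?A - {w. w ! Suc n = j \<and> (\<forall>m\<in>{1..<Suc n}. w ! m \<noteq> j)}"
    then show "pmf (srw G (Suc n) v) w = 0" by auto
  next
    fix w assume w: "w \<in> {w. w ! Suc n = j \<and> (\<forall>m\<in>{1..<Suc n}. w ! m \<noteq> j)} - ?A"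
    then obtain m where "m < Suc n" "w ! m = j" "m \<notin> {1..<Suc n}" by auto
    then have "w ! 0 = j" by (cases m) auto
    then show "pmf (srw G (Suc n) v) w = 0"
      using that srw_nth_0[of w "Suc n" v] by (auto simp: pmf_eq_0_set_pmf)
  qed
  have "first_passage_prob G i j (Suc (Suc n)) =
      (\<Sum>v\<in>pverts G. pmf (srw_step G i) v * measure_pmf.prob (srw G (Suc n) v) ?A)"
    using assms(1) by (rule first_passage_prob_Suc)
  also have "\<dots> = killed_op G j (\<lambda>v. first_passage_prob G v j (Suc n)) i"
    unfolding killed_op_def using assms(2) pair_finite_verts
    by (subst sum.remove[of _ j]) (auto simp: j v simp del: srw.simps intro!: sum.cong)
  finally show ?thesis .
qed

lemma killed_op_cong:
  "(\<And>v. v \<in> pverts G \<Longrightarrow> f v = g v) \<Longrightarrow> killed_op G j f i = killed_op G j g i"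
  by (simp add: killed_op_def)

lemma killed_op_mono:
  "(\<And>v. v \<in> pverts G \<Longrightarrow> f v \<le> g v) \<Longrightarrow> killed_op G j f i \<le> killed_op G j g i"
  by (auto simp: killed_op_def intro!: sum_mono mult_left_mono)

lemma killed_op_diff:
  "killed_op G j (\<lambda>v. f v - g v) i = killed_op G j f i - killed_op G j g i"
  by (simp add: killed_op_def right_diff_distrib sum_subtractf)

lemma killed_op_cmult: "killed_op G j (\<lambda>v. c * f v) i = c * killed_op G j f i"
  by (simp add: killed_op_def sum_distrib_left mult_ac)

lemma killed_op_1:
  assumes "i \<in> pverts G" "j \<in> pverts G"
  shows "killed_op G j (\<lambda>_. 1) i = 1 - pmf (srw_step G i) j"
proof -
  have "(\<Sum>v\<in>pverts G. pmf (srw_step G i) v * 1) = 1"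
    using assms deg_pos[of i] by (subst sum_pmf_srw_step) (auto simp: deg_def)
  then show ?thesis
    unfolding killed_op_def using assms pair_finite_verts
    by (subst (asm) sum.remove[of _ j]) auto
qed

text \<open>Probability that the walk from the last argument avoids \<open>j\<close> at the times 1
  to \<open>n\<close>.\<close>

definition survival :: "'a \<Rightarrow> nat \<Rightarrow> 'a \<Rightarrow> real" where
  "survival j n = (killed_op G j ^^ n) (\<lambda>_. 1)"

lemma survival_0: "survival j 0 = (\<lambda>_. 1)"
  and survival_Suc: "survival j (Suc n) = killed_op G j (survival j n)"
  by (simp_all add: survival_def)

lemma survival_nonneg: "0 \<le> survival j n i"
  by (induction n arbitrary: i)
    (auto simp: survival_0 survival_Suc killed_op_def intro!: sum_nonneg)

lemma first_passage_prob_survival: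
  assumes "i \<in> pverts G" "j \<in> pverts G"
  shows "first_passage_prob G i j (Suc n) = survival j n i - survival j (Suc n) i"
  using assms(1)
proof (induction n arbitrary: i)
  case 0
  then show ?case
    using assms(2) by (simp add: first_passage_prob_1 survival_0 survival_Suc killed_op_1)
next
  case (Suc n)
  have "first_passage_prob G i j (Suc (Suc n)) =
      killed_op G j (\<lambda>v. survival j n v - survival j (Suc n) v) i"
    using Suc assms(2) by (simp add: first_passage_prob_Suc_Suc cong: killed_op_cong)
  then show ?case by (simp add: killed_op_diff survival_Suc)
qed

text \<open>Tail-sum formula: the mean is the sum of the survival probabilities. Subtracting their
  partial sums from \<open>h\<close> leaves an iterate of the killed operator on \<open>h\<close>,
  which survival controls because \<open>h\<close> is bounded.\<close>

lemma mean_first_passage_eqI: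
  assumes j: "j \<in> pverts G" and i: "i \<in> pverts G"
    and h: "\<And>v. v \<in> pverts G \<Longrightarrow> h v = 1 + killed_op G j h v"
  shows "mean_first_passage G i j = h i"
proof -
  define C where "C = Max ((\<lambda>v. \<bar>h v\<bar>) ` pverts G)"
  have C: "\<bar>h v\<bar> \<le> C" if "v \<in> pverts G" for v
    using that pair_finite_verts unfolding C_def by (intro Max_ge) auto
  define R where "R n v = h v - (\<Sum>m<n. survival j m v)" for n v
  have R_Suc: "R (Suc n) v = killed_op G j (R n) v" if "v \<in> pverts G" for n v
  proof -
    have "killed_op G j (R n) v = killed_op G j h v - (\<Sum>m<n. survival j (Suc m) v)"
      unfolding R_def
      by (simp add: killed_op_diff survival_Suc) (simp add: killed_op_def sum_distrib_left sum.swap[of _ "{..<n}"])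
    then show ?thesis
      using h[OF that] by (simp add: R_def sum.lessThan_Suc_shift survival_0 del: sum.lessThan_Suc)
  qed
  have R_bound: "\<bar>R n v\<bar> \<le> C * survival j n v" if "v \<in> pverts G" for n v
    using that
  proof (induction n arbitrary: v)
    case 0
    then show ?case using C by (simp add: R_def survival_0)
  next
    case (Suc n)
    have "killed_op G j (R n) v \<le> killed_op G j (\<lambda>v. C * survival j n v) v"
      by (rule killed_op_mono) (use Suc.IH in \<open>simp add: abs_le_iff\<close>)
    moreover have "killed_op G j (\<lambda>v. - C * survival j n v) v \<le> killed_op G j (R n) v"
      by (rule killed_op_mono) (use Suc.IH in \<open>simp add: abs_le_iff minus_le_iff\<close>)
    ultimately show ?case
      unfolding R_Suc[OF Suc.prems] survival_Suc abs_le_iff killed_op_cmult by simp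
  qed
  have survival_le_1: "survival j n v \<le> 1" if "v \<in> pverts G" for n v
    using that
  proof (induction n arbitrary: v)
    case (Suc n)
    have "survival j (Suc n) v \<le> killed_op G j (\<lambda>_. 1) v"
      unfolding survival_Suc by (rule killed_op_mono) (rule Suc.IH)
    then show ?case
      unfolding killed_op_1[OF Suc.prems j] using pmf_nonneg[of "srw_step G v" j] by linarith
  qed (simp add: survival_0)
  have C_nonneg: "0 \<le> C" using C[OF i] by linarith
  have sums: "(\<lambda>n. survival j n v) sums h v" if v: "v \<in> pverts G" for v
  proof -
    \<comment> \<open>Bounded partial sums make survival summable, hence null, and the remainder
      \<open>R\<close> vanishes with it.\<close>
    have "(\<Sum>m<n. survival j m v) \<le> 2 * C" for n
      using R_bound[OF v, of n] C[OF v] survival_le_1[OF v, of n]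
        mult_left_le[of "survival j n v" C] C_nonneg
      by (simp add: R_def abs_le_iff)
    then have "summable (\<lambda>n. survival j n v)"
      by (intro bounded_imp_summable[of _ "2 * C"] survival_nonneg)
        (metis lessThan_Suc_atMost)
    then have "(\<lambda>n. C * survival j n v) \<longlonglongrightarrow> C * 0"
      by (intro tendsto_mult tendsto_const summable_LIMSEQ_zero)
    then have "(\<lambda>n. R n v) \<longlonglongrightarrow> 0"
      by (intro Lim_null_comparison[of "\<lambda>n. R n v" "\<lambda>n. C * survival j n v"])
        (use R_bound[OF v] in auto)
    then have "(\<lambda>n. h v - R n v) \<longlonglongrightarrow> h v - 0"
      by (intro tendsto_diff tendsto_const)
    then show ?thesis by (simp add: sums_def R_def)
  qed
  have h_ge_1: "1 \<le> h v" if "v \<in> pverts G" for v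
    using sum_le_suminf[OF sums_summable[OF sums[OF that]], of "{0}"] sums_unique[OF sums[OF that]]
    by (simp add: survival_nonneg survival_0)
  have C_ge_1: "1 \<le> C" using C[OF i] h_ge_1[OF i] by linarith
  define \<rho> where "\<rho> = 1 - 1 / C"
  have \<rho>: "0 \<le> \<rho>" "\<rho> < 1" using C_ge_1 by (auto simp: \<rho>_def)
  \<comment> \<open>Since \<open>1 \<le> h \<le> C\<close>, the killed operator maps \<open>h\<close> to \<open>h - 1 \<le> (1 - 1 / C) h\<close>.\<close>
  have geom: "survival j n v \<le> \<rho> ^ n * h v" if "v \<in> pverts G" for n v
    using that
  proof (induction n arbitrary: v)
    case 0
    then show ?case by (simp add: survival_0 h_ge_1)
  next
    case (Suc n)
    have "survival j (Suc n) v \<le> \<rho> ^ n * killed_op G j h v"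
      unfolding survival_Suc killed_op_cmult[symmetric]
      by (rule killed_op_mono) (rule Suc.IH)
    also have "killed_op G j h v \<le> \<rho> * h v"
      using h[OF Suc.prems] C[OF Suc.prems] C_ge_1 by (simp add: \<rho>_def field_simps)
    finally show ?case using \<rho> by (simp add: mult_right_mono mult_ac)
  qed
  \<comment> \<open>Geometric decay beats the factor \<open>n\<close>; this removes the boundary
    term in the summation by parts below.\<close>
  have "(\<lambda>n. h i * (real n * \<rho> ^ n)) \<longlonglongrightarrow> h i * 0"
    using \<rho> by (intro tendsto_mult tendsto_const powser_times_n_limit_0) auto
  then have lim: "(\<lambda>n. real n * survival j n i) \<longlonglongrightarrow> 0"
    by (intro Lim_null_comparison[of "\<lambda>n. real n * survival j n i"])
      (use geom[OF i] in \<open>auto simp: survival_nonneg abs_mult mult_ac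
         intro!: always_eventually mult_left_mono\<close>)
  have "(\<Sum>n<N. real (Suc n) * first_passage_prob G i j (Suc n)) =
      (\<Sum>n<N. survival j n i) - real N * survival j N i" for N
    by (induction N) (simp_all add: first_passage_prob_survival[OF i j] algebra_simps)
  then have "(\<lambda>n. real (Suc n) * first_passage_prob G i j (Suc n)) sums (h i - 0)"
    unfolding sums_def using sums[OF i, unfolded sums_def] lim
    by (simp only:) (intro tendsto_diff)
  then have "(\<lambda>n. real n * first_passage_prob G i j n) sums h i"
    by (subst (asm) sums_Suc_iff) simp
  then show ?thesis by (simp add: mean_first_passage_def sums_iff)
qed

text \<open>Kac's formula. Averaging the first-step equations against \<open>p\<close>, stationarity
  turns the killed term into the sum over all vertices but \<open>j\<close>, so only the term at
  \<open>j\<close> and the total mass 1 remain.\<close>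

lemma pmf_stationary_eq:
  assumes p: "stationary G p" and j: "j \<in> pverts G"
    and h: "\<And>v. v \<in> pverts G \<Longrightarrow> h v = 1 + killed_op G j h v"
  shows "pmf p j * h j = 1"
proof -
  have sub: "set_pmf p \<subseteq> pverts G" and bind: "bind_pmf p (srw_step G) = p"
    using p by (auto simp: stationary_def)
  have eq: "pmf p v = (\<Sum>u\<in>pverts G. pmf p u * pmf (srw_step G u) v)" for v
    by (subst bind[symmetric], subst pmf_bind, subst integral_measure_pmf[of "pverts G"])
      (use sub pair_finite_verts in auto)
  have "(\<Sum>i\<in>pverts G. pmf p i * h i) =
      (\<Sum>i\<in>pverts G. pmf p i) + (\<Sum>i\<in>pverts G. pmf p i * killed_op G j h i)"
    by (subst sum.distrib[symmetric], rule sum.cong) (use h in \<open>auto simp: algebra_simps\<close>)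
  also have "(\<Sum>i\<in>pverts G. pmf p i) = 1"
    using sub by (rule sum_pmf_eq_1[OF pair_finite_verts])
  also have "(\<Sum>i\<in>pverts G. pmf p i * killed_op G j h i) = (\<Sum>v\<in>pverts G - {j}. pmf p v * h v)"
    unfolding killed_op_def sum_distrib_left
    by (subst sum.swap, rule sum.cong[OF refl], subst eq)
      (simp add: sum_distrib_right mult.assoc)
  finally show ?thesis
    using j pair_finite_verts by (subst (asm) sum.remove[of _ j]) auto
qed

section \<open>Volume and a stationary distribution\<close>

definition vol :: real where
  "vol = (\<Sum>u\<in>pverts G. deg G u)"

lemma vol_pos: "vol > 0"
  unfolding vol_def using pair_finite_verts verts_nonempty deg_pos by (intro sum_pos) auto

lemma vol_eq_card_arcs: "vol = real (card (parcs G))"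
proof -
  have "parcs G = Sigma (pverts G) (neighbors G)"
    by (auto simp: neighbors_def dest: in_arcsD1)
  then show ?thesis
    using pair_finite_verts finite_neighbors by (simp add: vol_def deg_def)
qed

lemma ex_stationary:
  obtains p where "stationary G p" "\<And>u. pmf p u = deg G u / vol"
proof
  \<comment> \<open>The tail of a uniformly chosen arc: proportional to the degree, and a
    \<open>pmf\<close> by construction.\<close>
  define p where "p = map_pmf fst (pmf_of_set (parcs G))"
  have arcs: "parcs G \<noteq> {}" "finite (parcs G)"
    using vol_pos pair_finite_arcs by (auto simp: vol_eq_card_arcs)
  have pmf: "pmf p u = deg G u / vol" for u
  proof -
    have "parcs G \<inter> fst -` {u} = Pair u ` neighbors G u"
      by (auto simp: neighbors_def)
    then have "card (parcs G \<inter> fst -` {u}) = card (neighbors G u)"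
      by (simp add: card_image inj_on_def)
    then show ?thesis
      using arcs by (simp add: p_def pmf_map measure_pmf_of_set deg_def vol_eq_card_arcs)
  qed
  have sub: "set_pmf p \<subseteq> pverts G"
    using arcs by (auto simp: p_def dest: in_arcsD1)
  have "pmf (bind_pmf p (srw_step G)) v = pmf p v" for v
  proof -
    have "pmf (bind_pmf p (srw_step G)) v =
        (\<Sum>u\<in>pverts G. pmf p u * pmf (srw_step G u) v)"
      by (subst pmf_bind, subst integral_measure_pmf[of "pverts G"])
        (use sub pair_finite_verts in auto)
    \<comment> \<open>The degree of \<open>u\<close> cancels against its step probability, so each
      neighbour sends the same mass to \<open>v\<close>.\<close>
    also have "\<dots> = (\<Sum>u\<in>neighbors G v. 1 / vol)"
    proof (intro sum.mono_neutral_cong_right pair_finite_verts neighbors_subset ballI)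
      fix u assume u: "u \<in> neighbors G v"
      then have "u \<in> pverts G" "v \<in> neighbors G u" "deg G u > 0"
        using neighbors_subset deg_pos neighbors_sym by blast+
      then show "pmf p u * pmf (srw_step G u) v = 1 / vol"
        by (simp add: pmf pmf_srw_step)
    qed (auto simp: pmf_srw_step neighbors_sym[of v])
    finally show ?thesis by (simp add: pmf deg_def)
  qed
  then show "stationary G p"
    using sub by (auto simp: stationary_def intro: pmf_eqI)
  show "pmf p u = deg G u / vol" for u by (rule pmf)
qed

end

section \<open>Kemeny's constant from effective resistances\<close>

text \<open>
  The Laplacian identity says that \<open>i \<mapsto> r i j - r i z\<close> is the potential of a current of strength 2
  from \<open>z\<close> to \<open>j\<close>; thus \<open>r\<close> is the effective resistance for unit conductances.
\<close>

locale resistance_graph = walk_graph G for G :: "'a pair_pre_digraph" +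
  fixes r :: "'a \<Rightarrow> 'a \<Rightarrow> real" and \<phi> :: "'a \<Rightarrow> real"
  assumes r_sym: "r i j = r j i"
    and r_self: "r i i = 0"
    and r_laplacian: "i \<in> pverts G \<Longrightarrow> j \<in> pverts G \<Longrightarrow>
      (\<Sum>v\<in>neighbors G i. r i j - r v j) = \<phi> i - (if i = j then 2 else 0)"
begin

definition hit :: "'a \<Rightarrow> 'a \<Rightarrow> real" where
  "hit i j = (\<Sum>z\<in>pverts G. deg G z * (r i j + r j z - r i z)) / 2"

lemma hit_self: "hit j j = 0"
  by (simp add: hit_def r_self)

text \<open>\<open>\<phi>\<close> cancels between the columns \<open>j\<close> and \<open>z\<close>
  of \<open>r\<close>, leaving point masses 2 at \<open>z\<close> and \<open>j\<close>. Weighting by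
  half the degree of \<open>z\<close> sums them to \<open>deg G i\<close> and
  \<open>vol\<close>.\<close>

lemma hit_laplacian:
  assumes "i \<in> pverts G" "j \<in> pverts G"
  shows "(\<Sum>v\<in>neighbors G i. hit i j - hit v j) = deg G i - (if i = j then vol else 0)"
proof -
  have "(\<Sum>v\<in>neighbors G i. hit i j - hit v j) =
      (\<Sum>v\<in>neighbors G i. \<Sum>z\<in>pverts G. deg G z * ((r i j - r v j) - (r i z - r v z)) / 2)"
    unfolding hit_def diff_divide_distrib[symmetric] sum_subtractf[symmetric] sum_divide_distrib
    by (intro sum.cong refl) (simp add: algebra_simps)
  also have "\<dots> = (\<Sum>z\<in>pverts G. deg G z *
      ((\<Sum>v\<in>neighbors G i. r i j - r v j) - (\<Sum>v\<in>neighbors G i. r i z - r v z)) / 2)"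
    by (subst sum.swap) (simp add: sum_subtractf[symmetric] sum_distrib_left sum_divide_distrib)
  also have "\<dots> = (\<Sum>z\<in>pverts G. (if i = z then deg G z else 0) - (if i = j then deg G z else 0))"
    using assms by (intro sum.cong refl) (auto simp: r_laplacian)
  also have "\<dots> = deg G i - (if i = j then vol else 0)"
    using assms pair_finite_verts by (simp add: sum_subtractf vol_def)
  finally show ?thesis .
qed

text \<open>First passage counts from time 1, so the diagonal must hold the mean return time,
  whereas \<open>hit\<close> vanishes there.\<close>

definition passage :: "'a \<Rightarrow> 'a \<Rightarrow> real" where
  "passage i j = (if i = j then vol / deg G j else hit i j)"

lemma passage_eq:
  assumes "i \<in> pverts G" "j \<in> pverts G"
  shows "passage i j = 1 + killed_op G j (\<lambda>v. passage v j) i"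
proof -
  have "killed_op G j (\<lambda>v. passage v j) i = (\<Sum>v\<in>pverts G. pmf (srw_step G i) v * hit v j)"
    unfolding killed_op_def using assms pair_finite_verts
    by (subst (2) sum.remove[of _ j]) (auto simp: hit_self passage_def)
  also have "\<dots> = (\<Sum>v\<in>neighbors G i. hit v j) / deg G i"
    using assms(1) by (rule sum_pmf_srw_step)
  also have "(\<Sum>v\<in>neighbors G i. hit v j) = deg G i * hit i j - deg G i + (if i = j then vol else 0)"
    using hit_laplacian[OF assms] by (simp add: sum_subtractf deg_def)
  finally have "killed_op G j (\<lambda>v. passage v j) i =
      (deg G i * hit i j - deg G i + (if i = j then vol else 0)) / deg G i" .
  then show ?thesis
    using deg_pos[OF assms(1)] unfolding passage_def[of i]
    by (auto simp: hit_self diff_divide_distrib add_divide_distrib)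
qed

lemma mean_first_passage_eq:
  "i \<in> pverts G \<Longrightarrow> j \<in> pverts G \<Longrightarrow> mean_first_passage G i j = passage i j"
  using passage_eq by (intro mean_first_passage_eqI) auto

text \<open>Kac's formula forces any stationary law to have mass \<open>1 / passage j j\<close> at
  each vertex \<open>j\<close>, which gives uniqueness.\<close>

lemma pmf_stationary_dist:
  assumes "u \<in> pverts G"
  shows "pmf (stationary_dist G) u = deg G u / vol"
proof -
  obtain p where p: "stationary G p" "\<And>u. pmf p u = deg G u / vol"
    using ex_stationary by blast
  have "q = p" if q: "stationary G q" for q
  proof (rule pmf_eqI)
    fix j
    show "pmf q j = pmf p j"
    proof (cases "j \<in> pverts G")
      case True
      have "pmf q j * passage j j = 1" "pmf p j * passage j j = 1"
        using pmf_stationary_eq[OF _ True, where h = "\<lambda>v. passage v j"] passage_eq[OF _ True] p(1) q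
        by auto
      then show ?thesis by (metis mult_cancel_right mult_zero_right zero_neq_one)
    next
      case False
      then have "j \<notin> set_pmf q" "j \<notin> set_pmf p" using p(1) q by (auto simp: stationary_def)
      then show ?thesis by (simp add: set_pmf_iff)
    qed
  qed
  then have "stationary_dist G = p"
    unfolding stationary_dist_def using p(1) by (intro the_equality)
  then show ?thesis by (simp add: p)
qed

lemma kemeny_sum:
  assumes "i \<in> pverts G"
  shows "(\<Sum>j\<in>pverts G - {i}. mean_first_passage G i j * pmf (stationary_dist G) j) =
    (\<Sum>i\<in>pverts G. \<Sum>j\<in>pverts G. deg G i * deg G j * r i j) / (2 * vol)"
proof -
  let ?V = "pverts G" and ?d = "deg G"
  have "(\<Sum>j\<in>?V - {i}. mean_first_passage G i j * pmf (stationary_dist G) j) =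
      (\<Sum>j\<in>?V - {i}. hit i j * (?d j / vol))"
    using assms by (intro sum.cong refl)
      (auto simp: mean_first_passage_eq passage_def pmf_stationary_dist)
  also have "\<dots> = (\<Sum>j\<in>?V. hit i j * (?d j / vol))"
    using assms pair_finite_verts by (subst (2) sum.remove[of _ i]) (simp_all add: hit_self)
  also have "\<dots> = (\<Sum>j\<in>?V. \<Sum>z\<in>?V. ?d j * ?d z * r i j + ?d j * ?d z * r j z - ?d j * ?d z * r i z)
      / (2 * vol)"
    unfolding hit_def sum_divide_distrib sum_distrib_right
    by (intro sum.cong refl) (use vol_pos in \<open>simp add: field_simps\<close>)
  also have "(\<Sum>j\<in>?V. \<Sum>z\<in>?V. ?d j * ?d z * r i j + ?d j * ?d z * r j z - ?d j * ?d z * r i z) =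
      (\<Sum>j\<in>?V. \<Sum>z\<in>?V. ?d j * ?d z * r i j) + (\<Sum>j\<in>?V. \<Sum>z\<in>?V. ?d j * ?d z * r j z)
      - (\<Sum>j\<in>?V. \<Sum>z\<in>?V. ?d j * ?d z * r i z)"
    by (simp add: sum.distrib sum_subtractf)
  \<comment> \<open>Exchanging \<open>j\<close> and \<open>z\<close> cancels the two sums that
    involve the start \<open>i\<close>.\<close>
  also have "(\<Sum>j\<in>?V. \<Sum>z\<in>?V. ?d j * ?d z * r i z) = (\<Sum>j\<in>?V. \<Sum>z\<in>?V. ?d j * ?d z * r i j)"
    by (subst sum.swap) (simp add: mult_ac)
  finally show ?thesis by simp
qed

theorem kemeny_eq:
  "kemeny G = (\<Sum>i\<in>pverts G. \<Sum>j\<in>pverts G. deg G i * deg G j * r i j) / (2 * vol)"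
  unfolding kemeny_def using verts_nonempty by (intro the_equality) (auto simp: kemeny_sum)

end

section \<open>Paths and paths with one chord\<close>

lemma pverts_path_graph: "pverts (path_graph k) = {1..k}"
  by (simp add: path_graph_def)

lemma neighbors_path:
  assumes "i \<in> {1..k}"
  shows "neighbors (path_graph k) i =
    (if 1 < i then {i - 1} else {}) \<union> (if i < k then {i + 1} else {})"
  using assms by (auto simp: neighbors_def path_graph_def)

lemma sum_neighbors_path:
  fixes f :: "nat \<Rightarrow> real"
  assumes "i \<in> {1..k}"
  shows "(\<Sum>v\<in>neighbors (path_graph k) i. f v) =
    (if 1 < i then f (i - 1) else 0) + (if i < k then f (i + 1) else 0)"
  using assms by (auto simp: neighbors_path)

text \<open>Degree-weighted sums regrouped edge by edge: they telescope once
  \<open>f i + f (Suc i)\<close> has an explicit primitive.\<close>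

definition edge_sum :: "nat \<Rightarrow> (nat \<Rightarrow> real) \<Rightarrow> real" where
  "edge_sum k f = (\<Sum>i=1..<k. f i + f (Suc i))"

lemma sum_deg_path:
  assumes "k \<ge> 1"
  shows "(\<Sum>i\<in>{1..k}. deg (path_graph k) i * f i) = edge_sum k f"
proof -
  have deg: "deg (path_graph k) i = (if i \<noteq> 1 then 1 else 0) + (if i \<noteq> k then 1 else 0)"
    if "i \<in> {1..k}" for i
    using sum_neighbors_path[OF that, of "\<lambda>_. 1"] that by (simp add: deg_def)
  have "(\<Sum>i\<in>{1..k}. deg (path_graph k) i * f i) =
      (\<Sum>i\<in>{1..k}. if i \<noteq> 1 then f i else 0) + (\<Sum>i\<in>{1..k}. if i \<noteq> k then f i else 0)"
    unfolding sum.distrib[symmetric] by (intro sum.cong refl) (simp add: deg del: One_nat_def)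
  also have "(\<Sum>i\<in>{1..k}. if i \<noteq> 1 then f i else 0) = (\<Sum>i=Suc 1..<Suc k. f i)"
    by (intro sum.mono_neutral_cong_right) auto
  also have "\<dots> = (\<Sum>i=1..<k. f (Suc i))"
    by (rule sum.shift_bounds_Suc_ivl)
  also have "(\<Sum>i\<in>{1..k}. if i \<noteq> k then f i else 0) = (\<Sum>i=1..<k. f i)"
    by (intro sum.mono_neutral_cong_right) auto
  finally show ?thesis by (simp add: edge_sum_def sum.distrib)
qed

lemma edge_sum_telescope:
  assumes "k \<ge> 1" "\<And>i. 1 \<le> i \<Longrightarrow> i < k \<Longrightarrow> f i + f (Suc i) = g (Suc i) - g i"
  shows "edge_sum k f = g k - g 1"
proof -
  have "edge_sum k f = (\<Sum>i=1..<k. g (Suc i) - g i)"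
    unfolding edge_sum_def using assms by (intro sum.cong) auto
  then show ?thesis using sum_Suc_diff'[of 1 k g] assms(1) by simp
qed

lemma edge_sum_const: "k \<ge> 1 \<Longrightarrow> edge_sum k (\<lambda>_. c) = 2 * (real k - 1) * c"
  by (simp add: edge_sum_def of_nat_diff algebra_simps)

lemma edge_sum_abs:
  assumes "j \<in> {1..k}"
  shows "edge_sum k (\<lambda>i. \<bar>real i - real j\<bar>) = (real j - 1)\<^sup>2 + (real k - real j)\<^sup>2"
proof -
  \<comment> \<open>For integers \<open>x\<close>, \<open>\<bar>x\<bar> + \<bar>x + 1\<bar>\<close>
    is the increment of \<open>x * \<bar>x\<bar>\<close>.\<close>
  define g where "g i = (real i - real j) * \<bar>real i - real j\<bar>" for i
  have "\<bar>real i - real j\<bar> + \<bar>real (Suc i) - real j\<bar> = g (Suc i) - g i" for i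
  proof (cases "i < j")
    case True
    then have "\<bar>real i - real j\<bar> = real j - real i" "\<bar>real (Suc i) - real j\<bar> = real j - real (Suc i)"
      by auto
    then show ?thesis by (simp add: g_def algebra_simps)
  qed (simp add: g_def algebra_simps)
  then have "edge_sum k (\<lambda>i. \<bar>real i - real j\<bar>) = g k - g 1"
    using assms by (intro edge_sum_telescope) auto
  moreover have "g k = (real k - real j)\<^sup>2" "g 1 = - (real j - 1)\<^sup>2"
    using assms by (simp_all add: g_def power2_eq_square algebra_simps)
  ultimately show ?thesis by simp
qed

lemma edge_sum_squares:
  assumes "k \<ge> 1"
  shows "edge_sum k (\<lambda>j. (real j - 1)\<^sup>2 + (real k - real j)\<^sup>2) =
    2 * (2 * (real k - 1) ^ 3 + (real k - 1)) / 3"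
proof -
  \<comment> \<open>The increment of \<open>(2 * t ^ 3 + t) / 3\<close> is the sum of the squares of
    \<open>t\<close> and \<open>t + 1\<close>; the second cubic runs backwards, hence its
    sign.\<close>
  define g where "g j = (2 * (real j - 1) ^ 3 + (real j - 1)) / 3
      - (2 * (real k - real j) ^ 3 + (real k - real j)) / 3" for j
  have "edge_sum k (\<lambda>j. (real j - 1)\<^sup>2 + (real k - real j)\<^sup>2) = g k - g 1"
    using assms
    by (intro edge_sum_telescope) (auto simp: g_def power2_eq_square power3_eq_cube field_simps)
  then show ?thesis by (simp add: g_def)
qed

lemma walk_graph_path:
  assumes "k \<ge> 2"
  shows "walk_graph (path_graph k)"
proof -
  interpret pair_graph "path_graph k" by (rule pair_graph_path_graph)
  show ?thesis
    using assms by unfold_locales (auto simp: pverts_path_graph neighbors_path)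
qed

text \<open>The slope jumps by 2 at \<open>j\<close>, and each end lacks one neighbour; the end
  terms do not depend on \<open>j\<close>, as a source \<open>\<phi>\<close> requires.\<close>

lemma laplacian_path_abs:
  assumes "i \<in> {1..k}" "j \<in> {1..k}" "k \<ge> 2"
  shows "(\<Sum>v\<in>neighbors (path_graph k) i. \<bar>real i - real j\<bar> - \<bar>real v - real j\<bar>) =
    (if i = 1 \<or> i = k then 1 else 0) - (if i = j then 2 else 0)"
  unfolding sum_neighbors_path[OF assms(1)] using assms
  by (auto simp: of_nat_diff abs_if split: if_splits)

lemma kemeny_path:
  assumes "k \<ge> 2"
  shows "kemeny (path_graph k) = (2 * (real k - 1)\<^sup>2 + 1) / 6"
proof -
  let ?G = "path_graph k"
  interpret walk_graph ?G using assms by (rule walk_graph_path)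
  interpret resistance_graph ?G "\<lambda>i j. \<bar>real i - real j\<bar>" "\<lambda>i. if i = 1 \<or> i = k then 1 else 0"
    using assms laplacian_path_abs by unfold_locales (auto simp: pverts_path_graph)
  have vol: "vol = 2 * (real k - 1)"
    using sum_deg_path[of k "\<lambda>_. 1"] edge_sum_const[of k 1] assms
    by (simp add: vol_def pverts_path_graph)
  have "(\<Sum>i\<in>pverts ?G. \<Sum>j\<in>pverts ?G. deg ?G i * deg ?G j * \<bar>real i - real j\<bar>) =
      (\<Sum>i\<in>{1..k}. deg ?G i * (\<Sum>j\<in>{1..k}. deg ?G j * \<bar>real j - real i\<bar>))"
    by (simp add: pverts_path_graph sum_distrib_left mult.assoc abs_minus_commute)
  also have "\<dots> = (\<Sum>i\<in>{1..k}. deg ?G i * ((real i - 1)\<^sup>2 + (real k - real i)\<^sup>2))"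
    using assms by (intro sum.cong refl, subst sum_deg_path) (simp_all add: edge_sum_abs)
  also have "\<dots> = 2 * (2 * (real k - 1) ^ 3 + (real k - 1)) / 3"
    using assms by (subst sum_deg_path) (simp_all add: edge_sum_squares)
  finally show ?thesis
    using assms unfolding kemeny_eq vol
    by (simp add: field_simps power2_eq_square power3_eq_cube)
qed

section \<open>The path with one chord\<close>

locale chord_path =
  fixes k a b :: nat
  assumes ab: "1 \<le> a" "a + 2 \<le> b" "b \<le> k"
begin

abbreviation "P \<equiv> path_graph k"
abbreviation "G \<equiv> add_edge P a b"

text \<open>Number of path edges on the cycle, one less than its length.\<close>

definition L :: real where "L = real b - real a"

\<comment> \<open>Position along the cycle of the cycle vertex closest to \<open>i\<close>.\<close>
definition cl :: "nat \<Rightarrow> real" where "cl i = real (min (max i a) b) - real a"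

lemma cl_simps:
  "i \<le> a \<Longrightarrow> cl i = 0"
  "a \<le> i \<Longrightarrow> i \<le> b \<Longrightarrow> cl i = real i - real a"
  "b \<le> i \<Longrightarrow> cl i = L"
  using ab by (auto simp: cl_def L_def)

lemma cl_ends: "cl a = 0" "cl b = L"
  using ab by (simp_all add: cl_def L_def)

lemma L_ge: "L \<ge> 2"
  using ab by (simp add: L_def)

lemma pverts_G: "pverts G = {1..k}"
  by (simp add: add_edge_def pverts_path_graph)

lemma sum_neighbors_G:
  fixes f :: "nat \<Rightarrow> real"
  assumes "i \<in> {1..k}"
  shows "(\<Sum>v\<in>neighbors G i. f v) =
    (\<Sum>v\<in>neighbors P i. f v) + (if i = a then f b else 0) + (if i = b then f a else 0)"
proof -
  have "neighbors G i = neighbors P i \<union> (if i = a then {b} else {}) \<union> (if i = b then {a} else {})"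
    by (auto simp: neighbors_def add_edge_def)
  moreover have "b \<notin> neighbors P a" "a \<notin> neighbors P b" "finite (neighbors P i)"
    using ab assms by (auto simp: neighbors_path)
  ultimately show ?thesis using ab by auto
qed

lemma sum_deg_G:
  "(\<Sum>i\<in>{1..k}. deg G i * f i) = edge_sum k f + f a + f b"
proof -
  have "(\<Sum>i\<in>{1..k}. deg G i * f i) = (\<Sum>i\<in>{1..k}. deg P i * f i +
      (if i = a then f i else 0) + (if i = b then f i else 0))"
  proof (intro sum.cong refl)
    fix i assume "i \<in> {1..k}"
    then show "deg G i * f i = deg P i * f i +
        (if i = a then f i else 0) + (if i = b then f i else 0)"
      using sum_neighbors_G[of i "\<lambda>_. 1"] by (auto simp: deg_def algebra_simps)
  qed
  then show ?thesis using ab sum_deg_path[of k f] by (simp add: sum.distrib)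
qed

sublocale walk_graph G
proof -
  interpret pair_graph G
    using ab by (intro pair_graph_add_edge pair_graph_path_graph) (auto simp: pverts_path_graph)
  show "walk_graph G"
  proof
    show "pverts G \<noteq> {}" using ab by (simp add: pverts_G)
    fix u assume "u \<in> pverts G"
    then have "neighbors P u \<noteq> {}" using ab by (auto simp: neighbors_path pverts_G)
    then show "neighbors G u \<noteq> {}" by (auto simp: neighbors_def add_edge_def)
  qed
qed

text \<open>\<open>cl\<close> is constant on the tails and has unit slope on the cycle. Only the
  values at \<open>a\<close> and \<open>b\<close> depend on \<open>y\<close>, and the chord will
  cancel that dependence.\<close>

lemma laplacian_path_cl:
  assumes i: "i \<in> {1..k}"
  shows "(\<Sum>v\<in>neighbors P i. (cl i - y)\<^sup>2 - (cl v - y)\<^sup>2) =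
    (if a < i \<and> i < b then - 2
     else if i = a then 2 * y - 1 else if i = b then 2 * (L - y) - 1 else 0)"
proof -
  consider "i < a" | "i = a" | "a < i" "i < b" | "i = b" | "b < i" by linarith
  then show ?thesis
  proof cases
    case 1
    then show ?thesis using ab i unfolding sum_neighbors_path[OF i] by (simp add: cl_simps)
  next
    case 2
    then show ?thesis
      using ab i unfolding sum_neighbors_path[OF i]
      by (simp add: cl_simps power2_eq_square algebra_simps)
  next
    case 3
    then show ?thesis
      using ab i unfolding sum_neighbors_path[OF i]
      by (simp add: cl_simps of_nat_diff power2_eq_square algebra_simps)
  next
    case 4
    then have "cl (i - 1) = L - 1" "cl i = L" "cl (i + 1) = L"
      using ab by (auto simp: cl_simps L_def of_nat_diff)
    with 4 ab show ?thesis
      unfolding sum_neighbors_path[OF i] by (simp only:) (simp add: power2_eq_square algebra_simps)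
  next
    case 5
    then show ?thesis using ab i unfolding sum_neighbors_path[OF i] by (simp add: cl_simps)
  qed
qed

lemma abs_diff_ends:
  "\<bar>real a - real j\<bar> - \<bar>real b - real j\<bar> = 2 * cl j - L"
  using ab by (auto simp: cl_def L_def abs_if min_def max_def)

text \<open>
  The arcs of lengths \<open>s\<close> and \<open>L + 1 - s\<close> of the cycle are connected in parallel, so the chord lowers
  the resistance \<open>s\<close> of the first one to \<open>s - s\<^sup>2 / (L + 1)\<close>.
\<close>

sublocale resistance_graph G
  "\<lambda>i j. \<bar>real i - real j\<bar> - (cl i - cl j)\<^sup>2 / (L + 1)"
  "\<lambda>i. (if i = 1 \<or> i = k then 1 else 0) +
    (if a < i \<and> i < b then 2 / (L + 1) else if i = a \<or> i = b then (1 - L) / (L + 1) else 0)"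
proof
  fix i j assume "i \<in> pverts G" "j \<in> pverts G"
  then have i: "i \<in> {1..k}" and j: "j \<in> {1..k}" by (auto simp: pverts_G)
  let ?r = "\<lambda>i j. \<bar>real i - real j\<bar> - (cl i - cl j)\<^sup>2 / (L + 1)"
  have "(\<Sum>v\<in>neighbors P i. ?r i j - ?r v j) =
      (\<Sum>v\<in>neighbors P i. \<bar>real i - real j\<bar> - \<bar>real v - real j\<bar>) -
      (\<Sum>v\<in>neighbors P i. (cl i - cl j)\<^sup>2 - (cl v - cl j)\<^sup>2) / (L + 1)"
    unfolding sum_divide_distrib sum_subtractf[symmetric]
    by (intro sum.cong refl) (simp add: diff_divide_distrib)
  then have path: "(\<Sum>v\<in>neighbors P i. ?r i j - ?r v j) =
      (if i = 1 \<or> i = k then 1 else 0) - (if i = j then 2 else 0) -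
      (if a < i \<and> i < b then - 2 else if i = a then 2 * cl j - 1
       else if i = b then 2 * (L - cl j) - 1 else 0) / (L + 1)"
    using laplacian_path_abs[OF i j] laplacian_path_cl[OF i, of "cl j"] ab by simp
  have "(cl j)\<^sup>2 - (L - cl j)\<^sup>2 = (2 * cl j - L) * L"
    by (simp add: power2_eq_square algebra_simps)
  then have "((cl j)\<^sup>2 - (L - cl j)\<^sup>2) / (L + 1) = (2 * cl j - L) * (L / (L + 1))"
    by simp
  also have "L / (L + 1) = 1 - 1 / (L + 1)"
    using L_ge by (simp add: field_simps)
  finally have chord: "?r a j - ?r b j = (2 * cl j - L) / (L + 1)"
    using abs_diff_ends[of j] by (simp add: cl_ends diff_divide_distrib right_diff_distrib)
  \<comment> \<open>Adding the drop along the chord eliminates \<open>cl j\<close>, so what remains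
    can serve as the source at \<open>a\<close>, and likewise at \<open>b\<close>.\<close>
  have a: "?r a j - ?r b j - (2 * cl j - 1) / (L + 1) = (1 - L) / (L + 1)"
    unfolding chord by (simp add: diff_divide_distrib[symmetric])
  have b: "?r b j - ?r a j - (2 * (L - cl j) - 1) / (L + 1) = (1 - L) / (L + 1)"
    unfolding minus_diff_eq[of "?r a j" "?r b j", symmetric] chord minus_divide_left
    by (simp add: diff_divide_distrib[symmetric])
  consider "i = a" | "i = b" | "i \<noteq> a" "i \<noteq> b" by blast
  then show "(\<Sum>v\<in>neighbors G i. ?r i j - ?r v j) =
      (if i = 1 \<or> i = k then 1 else 0) +
      (if a < i \<and> i < b then 2 / (L + 1) else if i = a \<or> i = b then (1 - L) / (L + 1) else 0) -
      (if i = j then 2 else 0)"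
  proof cases
    case 1
    then show ?thesis using ab a unfolding sum_neighbors_G[OF i] path by simp
  next
    case 2
    then show ?thesis using ab b unfolding sum_neighbors_G[OF i] path by simp
  next
    case 3
    then show ?thesis using ab unfolding sum_neighbors_G[OF i] path by auto
  qed
qed (auto simp: power2_commute)

section \<open>Degree-weighted moments of the position along the cycle\<close>

lemma edge_sum_cl: "edge_sum k cl = L\<^sup>2 + 2 * L * (real k - real b)"
proof -
  \<comment> \<open>The second summand accounts for the tail beyond \<open>b\<close>, where
    \<open>cl\<close> stays at \<open>L\<close> and each edge contributes
    \<open>2 * L\<close>.\<close>
  define g where "g i = (cl i)\<^sup>2 + 2 * L * (real (max i b) - real b)" for i
  have "cl i + cl (Suc i) = g (Suc i) - g i" for i
  proof -
    consider "i < a" | "a \<le> i" "i < b" | "b \<le> i" by linarith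
    then show ?thesis
      using ab by cases (auto simp: g_def cl_simps max_def power2_eq_square algebra_simps)
  qed
  then have "edge_sum k cl = g k - g 1"
    using ab by (intro edge_sum_telescope) auto
  then show ?thesis using ab by (simp add: g_def cl_simps max_def)
qed

lemma edge_sum_cl_sq:
  "edge_sum k (\<lambda>i. (cl i)\<^sup>2) = (2 * L ^ 3 + L) / 3 + 2 * L\<^sup>2 * (real k - real b)"
proof -
  define g where "g i = (2 * cl i ^ 3 + cl i) / 3 + 2 * L\<^sup>2 * (real (max i b) - real b)" for i
  have "(cl i)\<^sup>2 + (cl (Suc i))\<^sup>2 = g (Suc i) - g i" for i
  proof -
    consider "i < a" | "a \<le> i" "i < b" | "b \<le> i" by linarith
    then show ?thesis
      using ab
      by cases (auto simp: g_def cl_simps max_def power2_eq_square power3_eq_cube field_simps)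
  qed
  then have "edge_sum k (\<lambda>i. (cl i)\<^sup>2) = g k - g 1"
    using ab by (intro edge_sum_telescope) auto
  then show ?thesis using ab by (simp add: g_def cl_simps max_def)
qed

text \<open>First and, below, second degree-weighted moment of \<open>cl\<close>. The last summands
  \<open>L\<close> and \<open>L\<^sup>2\<close> come from the chord's endpoint
  \<open>b\<close>.\<close>

definition M1 :: real where "M1 = L\<^sup>2 + 2 * L * (real k - real b) + L"
definition M2 :: real where "M2 = (2 * L ^ 3 + L) / 3 + 2 * L\<^sup>2 * (real k - real b) + L\<^sup>2"
definition Q :: "nat \<Rightarrow> real" where "Q j = (real j - 1)\<^sup>2 + (real k - real j)\<^sup>2"

lemma sum_deg_G_const: "(\<Sum>i\<in>{1..k}. deg G i * c) = 2 * real k * c"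
  using ab unfolding sum_deg_G by (simp add: edge_sum_const algebra_simps)

lemma sum_deg_G_cl: "(\<Sum>i\<in>{1..k}. deg G i * cl i) = M1"
  unfolding sum_deg_G by (simp add: edge_sum_cl M1_def cl_ends)

lemma sum_deg_G_cl_sq: "(\<Sum>i\<in>{1..k}. deg G i * (cl i)\<^sup>2) = M2"
  unfolding sum_deg_G by (simp add: edge_sum_cl_sq M2_def cl_ends)

lemma sum_deg_G_abs:
  "j \<in> {1..k} \<Longrightarrow> (\<Sum>i\<in>{1..k}. deg G i * \<bar>real i - real j\<bar>) =
    Q j + \<bar>real a - real j\<bar> + \<bar>real b - real j\<bar>"
  unfolding sum_deg_G by (simp add: edge_sum_abs Q_def)

lemma sum_deg_G_Q:
  "(\<Sum>i\<in>{1..k}. deg G i * Q i) = 2 * (2 * (real k - 1) ^ 3 + (real k - 1)) / 3 + Q a + Q b"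
  using ab unfolding sum_deg_G by (simp add: edge_sum_squares Q_def)

text \<open>Expanding \<open>(cl i - cl j)\<^sup>2\<close> reduces the double sum to moments.
  \<open>Q a\<close> and \<open>Q b\<close> appear twice: from the extra degree at the chord's ends
  and from the distances to them.\<close>

lemma kemeny_chord:
  "kemeny G = (2 * (2 * (real k - 1) ^ 3 + (real k - 1)) / 3 + 2 * Q a + 2 * Q b + 2 * L
     - (4 * real k * M2 - 2 * M1\<^sup>2) / (L + 1)) / (4 * real k)"
proof -
  let ?d = "deg G" and ?r = "\<lambda>i j. \<bar>real i - real j\<bar> - (cl i - cl j)\<^sup>2 / (L + 1)"
  have vol: "vol = 2 * real k"
    using sum_deg_G_const[of 1] by (simp add: vol_def pverts_G)
  have inner: "(\<Sum>j\<in>{1..k}. ?d j * ?r i j) = Q i + \<bar>real i - real a\<bar> + \<bar>real i - real b\<bar>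
      - (2 * real k * (cl i)\<^sup>2 - 2 * cl i * M1 + M2) / (L + 1)" if "i \<in> {1..k}" for i
  proof -
    have "(\<Sum>j\<in>{1..k}. ?d j * ?r i j) = (\<Sum>j\<in>{1..k}. ?d j * \<bar>real j - real i\<bar>
        - (?d j * (cl i)\<^sup>2 - 2 * cl i * (?d j * cl j) + ?d j * (cl j)\<^sup>2) / (L + 1))"
      by (intro sum.cong refl)
        (simp add: power2_diff abs_minus_commute right_diff_distrib algebra_simps)
    also have "\<dots> = (\<Sum>j\<in>{1..k}. ?d j * \<bar>real j - real i\<bar>) - ((\<Sum>j\<in>{1..k}. ?d j * (cl i)\<^sup>2)
        - 2 * cl i * (\<Sum>j\<in>{1..k}. ?d j * cl j) + (\<Sum>j\<in>{1..k}. ?d j * (cl j)\<^sup>2)) / (L + 1)"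
      by (simp add: sum_subtractf sum.distrib sum_distrib_left sum_divide_distrib[symmetric])
    finally show ?thesis
      using that unfolding sum_deg_G_const sum_deg_G_cl sum_deg_G_cl_sq sum_deg_G_abs[OF that]
      by (simp add: abs_minus_commute)
  qed
  have "(\<Sum>i\<in>{1..k}. \<Sum>j\<in>{1..k}. ?d i * ?d j * ?r i j) =
      (\<Sum>i\<in>{1..k}. ?d i * (\<Sum>j\<in>{1..k}. ?d j * ?r i j))"
    by (simp add: sum_distrib_left mult.assoc)
  also have "\<dots> = (\<Sum>i\<in>{1..k}. ?d i * Q i + ?d i * \<bar>real i - real a\<bar> + ?d i * \<bar>real i - real b\<bar>
      - (2 * real k * (?d i * (cl i)\<^sup>2) - 2 * M1 * (?d i * cl i) + ?d i * M2) / (L + 1))"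
    by (intro sum.cong refl, subst inner) (auto simp: algebra_simps)
  also have "\<dots> = (\<Sum>i\<in>{1..k}. ?d i * Q i) + (\<Sum>i\<in>{1..k}. ?d i * \<bar>real i - real a\<bar>)
      + (\<Sum>i\<in>{1..k}. ?d i * \<bar>real i - real b\<bar>)
      - (2 * real k * (\<Sum>i\<in>{1..k}. ?d i * (cl i)\<^sup>2) - 2 * M1 * (\<Sum>i\<in>{1..k}. ?d i * cl i)
         + (\<Sum>i\<in>{1..k}. ?d i * M2)) / (L + 1)"
    by (simp add: sum_subtractf sum.distrib sum_distrib_left sum_divide_distrib[symmetric])
  also have "(\<Sum>i\<in>{1..k}. ?d i * \<bar>real i - real a\<bar>) = Q a + L"
    using ab by (subst sum_deg_G_abs) (auto simp: L_def)
  also have "(\<Sum>i\<in>{1..k}. ?d i * \<bar>real i - real b\<bar>) = Q b + L"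
    using ab by (subst sum_deg_G_abs) (auto simp: L_def)
  finally show ?thesis
    unfolding kemeny_eq vol pverts_G
    unfolding sum_deg_G_Q sum_deg_G_const sum_deg_G_cl sum_deg_G_cl_sq
    by (simp add: power2_eq_square algebra_simps)
qed

text \<open>After clearing \<open>k\<close> and \<open>L + 1\<close> this is a polynomial identity
  in the tail sizes and \<open>L\<close>. For given \<open>k\<close> and \<open>L\<close>, only
  \<open>p * q\<close> depends on the chord's position.\<close>

lemma kemeny_chord_diff:
  defines "p \<equiv> real a - 1" and "q \<equiv> real k - real b"
  shows "kemeny G - kemeny P =
    (4 * (p + q)\<^sup>2 - 4 * L\<^sup>2 * (p + q) - (L - 1)\<^sup>2 * (L + 1)
      - 12 * p * q * (1 + L\<^sup>2 / (L + 1))) / (6 * real k)"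
proof -
  have k: "real k = p + q + L + 1" "real k > 0" and Lnz: "L + 1 \<noteq> 0"
    using ab L_ge by (auto simp: p_def q_def L_def)
  have Qa: "Q a = p\<^sup>2 + (q + L)\<^sup>2" and Qb: "Q b = (p + L)\<^sup>2 + q\<^sup>2"
    by (simp_all add: Q_def p_def q_def L_def power2_eq_square algebra_simps)
  have M: "M1 = L\<^sup>2 + 2 * L * q + L" "M2 = (2 * L ^ 3 + L) / 3 + 2 * L\<^sup>2 * q + L\<^sup>2"
    by (simp_all add: M1_def M2_def q_def)
  have kP: "kemeny P = (2 * (p + q + L)\<^sup>2 + 1) / 6"
    using ab kemeny_path[of k] by (simp add: k(1))
  have clear: "(L + 1) * (x - z / (L + 1)) = (L + 1) * x - z" for x z
    using Lnz by (simp add: right_diff_distrib)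
  have "4 * real k * kemeny G = 2 * (2 * (p + q + L) ^ 3 + (p + q + L)) / 3
      + 2 * Q a + 2 * Q b + 2 * L - (4 * real k * M2 - 2 * M1\<^sup>2) / (L + 1)"
    unfolding kemeny_chord using k(2) by (simp add: k(1))
  then have "(L + 1) * (4 * real k * kemeny G) =
      (L + 1) * (2 * (2 * (p + q + L) ^ 3 + (p + q + L)) / 3 + 2 * Q a + 2 * Q b + 2 * L)
      - (4 * real k * M2 - 2 * M1\<^sup>2)"
    by (simp only: clear)
  moreover have "6 * real k * (L + 1) * (kemeny G - kemeny P) =
      3 / 2 * ((L + 1) * (4 * real k * kemeny G)) - 6 * real k * (L + 1) * kemeny P"
    by (simp add: algebra_simps)
  ultimately have "6 * real k * (L + 1) * (kemeny G - kemeny P) =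
      3 / 2 * ((L + 1) * (2 * (2 * (p + q + L) ^ 3 + (p + q + L)) / 3 + 2 * Q a + 2 * Q b + 2 * L)
      - (4 * real k * M2 - 2 * M1\<^sup>2)) - 6 * real k * (L + 1) * kemeny P"
    by simp
  also have "\<dots> =
      (L + 1) * (4 * (p + q)\<^sup>2 - 4 * L\<^sup>2 * (p + q) - (L - 1)\<^sup>2 * (L + 1) - 12 * p * q)
      - 12 * p * q * L\<^sup>2"
    unfolding kP Qa Qb M k(1) by (simp add: field_simps power2_eq_square power3_eq_cube)
  also have "\<dots> = (L + 1) * (4 * (p + q)\<^sup>2 - 4 * L\<^sup>2 * (p + q) - (L - 1)\<^sup>2 * (L + 1)
      - 12 * p * q * (1 + L\<^sup>2 / (L + 1)))"
    using Lnz by (simp add: right_diff_distrib distrib_left)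
  finally have "6 * real k * (kemeny G - kemeny P) = 4 * (p + q)\<^sup>2 - 4 * L\<^sup>2 * (p + q)
      - (L - 1)\<^sup>2 * (L + 1) - 12 * p * q * (1 + L\<^sup>2 / (L + 1))"
    using Lnz by (simp only: mult.assoc mult.left_commute[of _ "L + 1"] mult_cancel_left) simp
  then show ?thesis
    using k(2) by (simp add: eq_divide_eq mult_ac)
qed

end

text \<open>
  The positive root in \<open>N\<close> lies strictly between \<open>L\<^sup>2 + L / 4 - 1 / 2\<close> and \<open>L\<^sup>2 + L / 4 - 5 / 16\<close>, and no
  multiple of \<open>1 / 4\<close> lies between these two numbers.
\<close>

lemma quadratic_threshold:
  fixes N L :: int
  assumes "L \<ge> 2" "N \<ge> 0"
  shows "4 * N\<^sup>2 - 4 * L\<^sup>2 * N - (L - 1)\<^sup>2 * (L + 1) > 0 \<longleftrightarrow> 16 * N > 16 * L\<^sup>2 + 4 * L - 5"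
proof
  assume "16 * N > 16 * L\<^sup>2 + 4 * L - 5"
  \<comment> \<open>Integrality rounds the bound up to the next integer. Four times the quadratic is
    then at least \<open>(L - 1) * (L + 3)\<close>.\<close>
  then have "4 * N \<ge> 4 * L\<^sup>2 + L - 1" by presburger
  then have "(4 * L\<^sup>2 + L - 1) * (L - 1) \<le> 4 * N * (4 * N - 4 * L\<^sup>2)"
    using assms by (intro mult_mono) auto
  moreover have "L * L \<ge> 2 * 2" using assms by (intro mult_mono) auto
  ultimately show "4 * N\<^sup>2 - 4 * L\<^sup>2 * N - (L - 1)\<^sup>2 * (L + 1) > 0"
    using assms by (simp add: power2_eq_square algebra_simps)
next
  assume pos: "4 * N\<^sup>2 - 4 * L\<^sup>2 * N - (L - 1)\<^sup>2 * (L + 1) > 0"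
  show "16 * N > 16 * L\<^sup>2 + 4 * L - 5"
  proof (rule ccontr)
    assume "\<not> 16 * N > 16 * L\<^sup>2 + 4 * L - 5"
    then have le: "4 * N \<le> 4 * L\<^sup>2 + L - 2" by presburger
    \<comment> \<open>This bound makes four times the quadratic at most
      \<open>- 3 * L\<^sup>2\<close>. The case split supplies the sign condition for multiplying
      inequalities.\<close>
    have "4 * N * (4 * N - 4 * L\<^sup>2) \<le> (4 * L\<^sup>2 + L - 2) * (L - 2)"
    proof (cases "N \<le> L\<^sup>2")
      case True
      then have "4 * N * (4 * N - 4 * L\<^sup>2) \<le> 0"
        using assms by (intro mult_nonneg_nonpos) auto
      also have "0 \<le> (4 * L\<^sup>2 + L - 2) * (L - 2)"
        using assms by (intro mult_nonneg_nonneg) (auto intro: add_increasing)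
      finally show ?thesis .
    next
      case False
      then show ?thesis using assms le by (intro mult_mono) auto
    qed
    moreover have "L * L \<ge> 2 * 2" using assms by (intro mult_mono) auto
    ultimately show False
      using pos by (simp add: power2_eq_square algebra_simps)
  qed
qed

theorem theorem3p4:
  fixes k l :: nat
  assumes "k \<ge> 3" and "l \<ge> 3"
  shows "(\<exists>i j. braess_edge (path_graph k) i j \<and> int j - int i + 1 = int l) \<longleftrightarrow>
         real k > (real l)\<^sup>2 - 3 / 4 * real l + 7 / 16"
proof -
  \<comment> \<open>The numerator of the increment when one tail is empty.\<close>
  define E where "E = (\<lambda>N L :: real. 4 * N\<^sup>2 - 4 * L\<^sup>2 * N - (L - 1)\<^sup>2 * (L + 1))"
  have threshold: "E (real k - real l) (real l - 1) > 0 \<longleftrightarrow>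
      real k > (real l)\<^sup>2 - 3 / 4 * real l + 7 / 16" if "l \<le> k"
  proof -
    let ?N = "int k - int l" and ?L = "int l - 1"
    have "E (real k - real l) (real l - 1) =
        real_of_int (4 * ?N\<^sup>2 - 4 * ?L\<^sup>2 * ?N - (?L - 1)\<^sup>2 * (?L + 1))"
      by (simp add: E_def)
    then have "E (real k - real l) (real l - 1) > 0 \<longleftrightarrow> 16 * ?N > 16 * ?L\<^sup>2 + 4 * ?L - 5"
      using quadratic_threshold[of ?L ?N] assms that by (simp only: of_int_0_less_iff)
    also have "\<dots> \<longleftrightarrow> real_of_int (16 * ?L\<^sup>2 + 4 * ?L - 5) < real_of_int (16 * ?N)"
      by (simp only: of_int_less_iff)
    \<comment> \<open>Substituting \<open>k - l\<close> and \<open>l - 1\<close> gives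
      \<open>16 * k > 16 * l\<^sup>2 - 12 * l + 7\<close>.\<close>
    also have "\<dots> \<longleftrightarrow> real k > (real l)\<^sup>2 - 3 / 4 * real l + 7 / 16"
      by (auto simp: power2_eq_square algebra_simps)
    finally show ?thesis .
  qed
  show ?thesis
  proof
    assume "\<exists>i j. braess_edge (path_graph k) i j \<and> int j - int i + 1 = int l"
    then obtain a b where br: "braess_edge (path_graph k) a b" and l: "int b - int a + 1 = int l"
      by blast
    \<comment> \<open>The integer equation for \<open>l \<ge> 3\<close> forces
      \<open>a + 2 \<le> b\<close>, which also fixes the orientation of the pair.\<close>
    then interpret chord_path k a b
      using assms by unfold_locales (auto simp: braess_edge_def pverts_path_graph)
    have L: "L = real l - 1" using l by (simp add: L_def)
    have N: "(real a - 1) + (real k - real b) = real k - real l" using l by simp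
    have "0 < kemeny G - kemeny P" using br by (simp add: braess_edge_def)
    then have "0 < E (real k - real l) L
        - 12 * (real a - 1) * (real k - real b) * (1 + L\<^sup>2 / (L + 1))"
      using assms unfolding kemeny_chord_diff N E_def by (simp add: zero_less_divide_iff)
    moreover have "0 \<le> 12 * (real a - 1) * (real k - real b) * (1 + L\<^sup>2 / (L + 1))"
      using ab L_ge by (intro mult_nonneg_nonneg add_nonneg_nonneg divide_nonneg_nonneg) auto
    ultimately have "0 < E (real k - real l) (real l - 1)" by (simp add: L)
    moreover have "l \<le> k" using l ab by linarith
    ultimately show "real k > (real l)\<^sup>2 - 3 / 4 * real l + 7 / 16" using threshold by blast
  next
    assume k: "real k > (real l)\<^sup>2 - 3 / 4 * real l + 7 / 16"
    \<comment> \<open>Ensures that the bound on \<open>k\<close> exceeds \<open>l\<close>, so that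
      the cycle fits into the path.\<close>
    have "real l * 3 \<le> real l * real l" using assms by (intro mult_left_mono) auto
    with k have "l \<le> k" by (simp add: power2_eq_square)
    \<comment> \<open>Starting the chord at vertex 1 empties one tail and removes the product
      term.\<close>
    then interpret chord_path k 1 l
      using assms by unfold_locales auto
    have "E (real k - real l) (real l - 1) > 0" using k threshold \<open>l \<le> k\<close> by blast
    moreover have "L = real l - 1" unfolding L_def by simp
    ultimately have "0 < kemeny G - kemeny P"
      using assms unfolding kemeny_chord_diff E_def by simp
    then have "braess_edge P 1 l"
      using assms \<open>l \<le> k\<close> by (auto simp: braess_edge_def path_graph_def)
    then show "\<exists>i j. braess_edge P i j \<and> int j - int i + 1 = int l" by force
  qed
qed

end
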